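(* Let $P$ be a non-exceptional isonemal periodic prefabric that has quarter-turn symmetry and that falls apart. Then there exist a fabric $F$ and a thick striping of the strands of $F$ such that the resulting pattern is the design of $P$, and such that $F$ is of species $33_4$ or the symmetry group of $F$ has a subgroup of Roth type $33_4$.
   Context: **Prefabrics.** The plane is divided into unit square cells $[i,i+1]\times[j,j+1]$, $i,j\in\mathbb{Z}$. Each column of cells is a vertical strand (a warp) and each row a horizontal strand (a weft). A prefabric specifies, for each cell, which of the two strands crossing there is on top (seen from the obverse side). Its design is the colouring of the cells in which a cell is dark if the warp is on top and pale if the weft is on top (normal colouring: dark warps, pale wefts). All prefabrics are periodic: the designs are invariant under two linearly independent translations. A prefabric falls apart if the set of strands can be partitioned into two nonempty sets $A,B$ such that wherever a strand of $A$ crosses a strand of $B$ the strand of $A$ is on top. A fabric is a prefabric that does not fall apart. **Symmetries.** A symmetry of a prefabric is a pair $(g,\varepsilon)$ where $g$ is an isometry of the plane mapping cells to cells and $\varepsilon\in\{e,\tau\}$ ($e$ = without reversal of sides, $\tau$ = reflection in the plane of the fabric, exchanging over and under), such that for every cell $c$ the strand on top at $c$ is carried by $g$ to the strand on top at $g(c)$ if $\varepsilon=e$, and to the strand underneath at $g(c)$ if $\varepsilon=\tau$. The symmetries form a group, the symmetry group. The prefabric has quarter-turn symmetry if this group contains some $(g,\varepsilon)$ with $g$ a rotation by $90^\circ$. The prefabric is isonemal if its symmetry group is transitive on the set of all strands (warps and wefts together). The order of an isonemal prefabric is the least positive integer $p$ such that the translation by $(p,0)$, without $\tau$, is a symmetry.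 **Exceptional prefabrics.** Roth's classification places isonemal periodic prefabrics in 39 species, apart from a finite list of exceptional ones (all of order at most $4$); non-exceptional means belonging to one of the 39 species. Species with quarter-turn symmetry (33–39) have no reflection or glide-reflection symmetries, so for a prefabric with quarter-turn symmetry, non-exceptional means that no symmetry $(g,\varepsilon)$ has $g$ a reflection or glide-reflection. **Species $33_4$.** A group is of (Roth) type $33_4$ if it is generated by the quarter-turns without $\tau$ about two points $c$ and $d$, where $c$ and $d$ are corners of cells and $d-c=(2a,2b)$ with $a,b$ coprime integers of opposite parity. A prefabric is of species $33_4$ if its (full) symmetry group is of type $33_4$. **Thick striping.** A thick striping colours the warps dark and pale alternately in adjacent pairs (dark, dark, pale, pale, dark, dark, ...), and likewise the wefts; the positions of the pairs among the warps and among the wefts are arbitrary. The pattern of a fabric with coloured strands is the colouring of the cells in which each cell has the colour of the strand on top there. *)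

theory Defs
  imports Complex_Main "HOL-Algebra.Generated_Groups"
begin

text \<open>The plane is the complex plane. The index pair (i, j) stands for the unit cell whose
  lower left corner is i + j \<i>; columns of cells are warps, rows are wefts.\<close>

datatype strand = Warp int | Weft int

definition cell :: "int \<times> int \<Rightarrow> complex set" where
  "cell c = {z. of_int (fst c) \<le> Re z \<and> Re z \<le> of_int (fst c) + 1 \<and>
                of_int (snd c) \<le> Im z \<and> Im z \<le> of_int (snd c) + 1}"

fun region :: "strand \<Rightarrow> complex set" where
  "region (Warp i) = (\<Union>j. cell (i, j))"
| "region (Weft j) = (\<Union>i. cell (i, j))"

definition strands_at :: "int \<times> int \<Rightarrow> strand set" where
  "strands_at c = {Warp (fst c), Weft (snd c)}"

text \<open>A prefabric is the predicate ``the warp is on top''. With dark (True) warps and pale (False)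
  wefts this predicate is at the same time the design of the prefabric.
  Periodicity is the separate predicate below.\<close>

type_synonym prefabric = "int \<times> int \<Rightarrow> bool"

definition top_strand :: "prefabric \<Rightarrow> int \<times> int \<Rightarrow> strand" where
  "top_strand P c = (if P c then Warp (fst c) else Weft (snd c))"

definition under_strand :: "prefabric \<Rightarrow> int \<times> int \<Rightarrow> strand" where
  "under_strand P c = (if P c then Weft (snd c) else Warp (fst c))"

definition periodic :: "prefabric \<Rightarrow> bool" where
  "periodic P \<longleftrightarrow>
     (\<exists>a b a' b' :: int.
        Complex (of_int a) (of_int b) \<noteq> Complex (of_int a') (of_int b') \<and>
        independent {Complex (of_int a) (of_int b), Complex (of_int a') (of_int b')} \<and>
        (\<forall>i j. P (i + a, j + b) = P (i, j)) \<and>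
        (\<forall>i j. P (i + a', j + b') = P (i, j)))"

definition falls_apart :: "prefabric \<Rightarrow> bool" where
  "falls_apart P \<longleftrightarrow>
     (\<exists>A B. A \<noteq> {} \<and> B \<noteq> {} \<and> A \<inter> B = {} \<and> A \<union> B = UNIV \<and>
        (\<forall>c. \<forall>s \<in> A \<inter> strands_at c. \<forall>t \<in> B \<inter> strands_at c. top_strand P c = s))"

definition fabric :: "prefabric \<Rightarrow> bool" where
  "fabric P \<longleftrightarrow> periodic P \<and> \<not> falls_apart P"

definition plane_isometry :: "(complex \<Rightarrow> complex) \<Rightarrow> bool" where
  "plane_isometry g \<longleftrightarrow> surj g \<and> (\<forall>z w. dist (g z) (g w) = dist z w)"

definition rotation :: "complex \<Rightarrow> complex \<Rightarrow> complex \<Rightarrow> complex" where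
  "rotation p u z = p + u * (z - p)"

definition quarter_turn :: "(complex \<Rightarrow> complex) \<Rightarrow> bool" where
  "quarter_turn g \<longleftrightarrow> (\<exists>p. g = rotation p \<i> \<or> g = rotation p (- \<i>))"

text \<open>Reflection in the line through p with unit direction u, followed by the translation by
  the vector t u along that line; a pure reflection is the case t = 0.\<close>

definition reflection_or_glide :: "(complex \<Rightarrow> complex) \<Rightarrow> bool" where
  "reflection_or_glide g \<longleftrightarrow>
     (\<exists>p u. \<exists>t::real. cmod u = 1 \<and> g = (\<lambda>z. p + u\<^sup>2 * cnj (z - p) + of_real t * u))"

text \<open>Pairs of a plane isometry and a side: the second component is True exactly when the pair
  involves \<tau>, the reversal of sides.\<close>

definition motion_group :: "((complex \<Rightarrow> complex) \<times> bool) monoid" where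
  "motion_group =
     \<lparr>carrier = {(g, \<epsilon>). plane_isometry g},
      mult = (\<lambda>(g, \<epsilon>) (h, \<delta>). (g \<circ> h, \<epsilon> \<noteq> \<delta>)),
      one = (id, False)\<rparr>"

definition symmetries :: "prefabric \<Rightarrow> ((complex \<Rightarrow> complex) \<times> bool) set" where
  "symmetries P =
     {(g, \<epsilon>). plane_isometry g \<and>
        (\<forall>c. \<exists>c'. g ` cell c = cell c' \<and>
           g ` region (top_strand P c) =
             region (if \<epsilon> then under_strand P c' else top_strand P c'))}"

definition symmetry_group :: "prefabric \<Rightarrow> ((complex \<Rightarrow> complex) \<times> bool) monoid" where
  "symmetry_group P = motion_group\<lparr>carrier := symmetries P\<rparr>"

definition quarter_turn_symmetry :: "prefabric \<Rightarrow> bool" where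
  "quarter_turn_symmetry P \<longleftrightarrow> (\<exists>(g, \<epsilon>) \<in> symmetries P. quarter_turn g)"

definition isonemal :: "prefabric \<Rightarrow> bool" where
  "isonemal P \<longleftrightarrow> (\<forall>s t. \<exists>(g, \<epsilon>) \<in> symmetries P. g ` region s = region t)"

text \<open>This is the meaning of non-exceptional only for prefabrics with quarter-turn symmetry.\<close>

definition non_exceptional :: "prefabric \<Rightarrow> bool" where
  "non_exceptional P \<longleftrightarrow> \<not> (\<exists>(g, \<epsilon>) \<in> symmetries P. reflection_or_glide g)"

definition type_33_4 :: "((complex \<Rightarrow> complex) \<times> bool) set \<Rightarrow> bool" where
  "type_33_4 H \<longleftrightarrow>
     (\<exists>c d. \<exists>a b k l :: int.
        c = Complex (of_int k) (of_int l) \<and>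
        d - c = Complex (of_int (2 * a)) (of_int (2 * b)) \<and>
        coprime a b \<and> (even a \<longleftrightarrow> odd b) \<and>
        H = generate motion_group {(rotation c \<i>, False), (rotation d \<i>, False)})"

definition species_33_4 :: "prefabric \<Rightarrow> bool" where
  "species_33_4 P \<longleftrightarrow> type_33_4 (symmetries P)"

text \<open>A colouring of the strands is the predicate ``dark''.\<close>

definition thick_striping :: "(strand \<Rightarrow> bool) \<Rightarrow> bool" where
  "thick_striping col \<longleftrightarrow>
     (\<exists>m. \<forall>i. col (Warp i) \<longleftrightarrow> (i - m) mod 4 < 2) \<and>
     (\<exists>n. \<forall>j. col (Weft j) \<longleftrightarrow> (j - n) mod 4 < 2)"

definition pattern :: "prefabric \<Rightarrow> (strand \<Rightarrow> bool) \<Rightarrow> int \<times> int \<Rightarrow> bool" where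
  "pattern F col c = col (top_strand F c)"

end

theory Submission
  imports Defs
begin

text \<open>Every symmetry is a Gaussian rotation \<open>z \<mapsto> u z + t\<close>. A strand and its images under a
  side-preserving quarter-turn form a cycle of over-crossings (or of under-crossings), so a partition
  witnessing that a prefabric falls apart is invariant under all such quarter-turns. For \<open>P\<close>, transitivity
  then makes the symmetries with \<open>\<tau>\<close> exchange the two parts, and a case analysis of the
  available translations shows that translation by \<open>2 + 2 n \<i>\<close> with odd \<open>n\<close> is a symmetry with
  \<open>\<tau>\<close>; hence the upper part consists of alternate adjacent pairs of warps and of wefts. Colour its
  warps and the wefts of the lower part dark. The design then determines the top strand exactly where
  the two strands have different colours; filling in the plain weave elsewhere gives a fabric \<open>F\<close> that
  admits side-preserving quarter-turns about two points generating a group of type \<open>33\<^sub>4\<close>. These already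
  act transitively on the strands, so the same cycle argument shows that \<open>F\<close> does not fall apart.\<close>

section \<open>Isometries that permute the cells\<close>

text \<open>Normalise \<open>g\<close> to an isometry \<open>h\<close> fixing 0 and 1: distances to
  these two points determine the real part of \<open>h z\<close> and its imaginary part up to
  sign.\<close>

lemma plane_isometry_cases:
  assumes "plane_isometry g"
  obtains u t where "cmod u = 1" "g = (\<lambda>z. u * z + t)"
  | u t where "cmod u = 1" "g = (\<lambda>z. u * cnj z + t)"
proof -
  define t where "t = g 0"
  define u where "u = g 1 - g 0"
  define h where "h z = (g z - t) / u" for z
  have d: "cmod (g z - g w) = cmod (z - w)" for z w
    using assms by (simp add: plane_isometry_def dist_norm)
  have u1: "cmod u = 1"
    using d[of 1 0] by (simp add: u_def)
  then have u0: "u \<noteq> 0" by auto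
  have g: "g z = u * h z + t" for z
    using u0 by (simp add: h_def)
  have hd: "cmod (h z - h w) = cmod (z - w)" for z w
  proof -
    have "g z - g w = u * (h z - h w)"
      by (simp add: g algebra_simps)
    then show ?thesis
      using d[of z w] u1 by (simp add: norm_mult)
  qed
  have h0: "h 0 = 0" by (simp add: h_def t_def)
  have h1: "h 1 = 1" using u0 by (simp add: h_def t_def u_def)
  have sq: "(Re (h z) - Re (h w))\<^sup>2 + (Im (h z) - Im (h w))\<^sup>2 = (Re z - Re w)\<^sup>2 + (Im z - Im w)\<^sup>2" for z w
  proof -
    have "(cmod (h z - h w))\<^sup>2 = (cmod (z - w))\<^sup>2" by (simp only: hd)
    then show ?thesis by (simp add: cmod_power2)
  qed
  have re: "Re (h z) = Re z" and im: "(Im (h z))\<^sup>2 = (Im z)\<^sup>2" for z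
  proof -
    show *: "Re (h z) = Re z"
      using sq[of z 0] sq[of z 1] by (simp add: h0 h1 power2_eq_square algebra_simps)
    show "(Im (h z))\<^sup>2 = (Im z)\<^sup>2"
      using sq[of z 0] by (simp add: h0 *)
  qed
  \<comment> \<open>The distance to \<open>\<i>\<close> ties the sign at \<open>z\<close> to the
    sign at \<open>\<i>\<close>, so one choice holds for the whole plane.\<close>
  have prod: "Im (h z) * Im (h \<i>) = Im z" for z
    using sq[of z \<i>] re[of z] re[of \<i>] im[of z] im[of \<i>]
    by (simp add: power2_eq_square algebra_simps)
  from im[of \<i>] consider "Im (h \<i>) = 1" | "Im (h \<i>) = - 1"
    by (auto simp: power2_eq_1_iff)
  then show thesis
  proof cases
    case 1
    then have "h z = z" for z
      using prod[of z] re[of z] by (simp add: complex_eq_iff)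
    then have "g = (\<lambda>z. u * z + t)" using g by auto
    then show thesis using that(1) u1 by blast
  next
    case 2
    have "h z = cnj z" for z
    proof -
      have "- Im (h z) = Im z" using prod[of z] by (simp add: 2)
      then show ?thesis using re[of z] by (simp add: complex_eq_iff)
    qed
    then have "g = (\<lambda>z. u * cnj z + t)" using g by auto
    then show thesis using that(2) u1 by blast
  qed
qed

text \<open>A square root \<open>v\<close> of \<open>u\<close> is the direction of the axis. In the
  frame of \<open>v\<close> the vector \<open>t\<close> becomes \<open>w\<close>: its real part is
  the glide, and half its imaginary part moves the axis off the origin.\<close>

lemma reflection_or_glide_cnj:
  assumes "cmod u = 1"
  shows "reflection_or_glide (\<lambda>z. u * cnj z + t)"
proof -
  define v where "v = csqrt u"
  have v2: "v\<^sup>2 = u" by (simp add: v_def)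
  have v1: "cmod v = 1" using assms by (simp add: v_def)
  have vv: "v * cnj v = 1"
    using complex_norm_square[of v] v1 by simp
  define w where "w = t * cnj v"
  define p where "p = v * \<i> * of_real (Im w / 2)"
  have "p - v\<^sup>2 * cnj p = v * \<i> * of_real (Im w / 2) + v * (v * cnj v) * \<i> * of_real (Im w / 2)"
    by (simp add: p_def power2_eq_square algebra_simps)
  also have "\<dots> = v * (\<i> * of_real (Im w))"
    by (simp add: vv)
  finally have "p - v\<^sup>2 * cnj p + of_real (Re w) * v = v * (of_real (Re w) + \<i> * of_real (Im w))"
    by (simp add: algebra_simps)
  also have "\<dots> = v * w" by (simp add: complex_eq[symmetric])
  also have "\<dots> = t" using vv by (simp add: w_def mult.left_commute)
  finally have t: "p - v\<^sup>2 * cnj p + of_real (Re w) * v = t" .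
  have "(\<lambda>z. u * cnj z + t) = (\<lambda>z. p + v\<^sup>2 * cnj (z - p) + of_real (Re w) * v)"
    by (simp add: t[symmetric] v2[symmetric] algebra_simps)
  then show ?thesis using v1 unfolding reflection_or_glide_def by blast
qed

text \<open>At distance sqrt 2 inside a unit square both coordinates must differ by exactly 1. This
  is how an isometry permuting cells is seen to map lattice points to lattice points.\<close>

lemma opposite_corners_of_cell:
  assumes z: "z \<in> cell c" and w: "w \<in> cell c" and d: "(dist z w)\<^sup>2 = 2"
  shows "\<exists>a b :: int. z = Complex (of_int a) (of_int b)"
proof -
  have b: "\<bar>Re z - Re w\<bar> \<le> 1" "\<bar>Im z - Im w\<bar> \<le> 1"
    using z w by (auto simp: cell_def)
  then have le: "(Re z - Re w)\<^sup>2 \<le> 1" "(Im z - Im w)\<^sup>2 \<le> 1"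
    by (auto simp: abs_square_le_1)
  have "(Re z - Re w)\<^sup>2 + (Im z - Im w)\<^sup>2 = 2"
    using d by (simp add: dist_norm cmod_power2)
  with le have "(Re z - Re w)\<^sup>2 = 1" "(Im z - Im w)\<^sup>2 = 1" by auto
  then have "Re z - Re w = 1 \<or> Re z - Re w = - 1" "Im z - Im w = 1 \<or> Im z - Im w = - 1"
    by (auto simp: power2_eq_1_iff)
  then have "Re z = of_int (fst c) \<or> Re z = of_int (fst c + 1)"
    "Im z = of_int (snd c) \<or> Im z = of_int (snd c + 1)"
    using z w by (auto simp: cell_def)
  then show ?thesis by (metis complex_surj)
qed

lemma corner_image:
  assumes g: "plane_isometry g" and c: "\<And>c. \<exists>c'. g ` cell c = cell c'"
  shows "\<exists>a b :: int. g (Complex (of_int i) (of_int j)) = Complex (of_int a) (of_int b)"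
proof -
  obtain c' where c': "g ` cell (i, j) = cell c'" using c by blast
  let ?z = "Complex (of_int i) (of_int j)" and ?w = "Complex (of_int i + 1) (of_int j + 1)"
  have "?z \<in> cell (i, j)" "?w \<in> cell (i, j)" by (auto simp: cell_def)
  then have "g ?z \<in> cell c'" "g ?w \<in> cell c'" using c' by blast+
  moreover have "(dist (g ?z) (g ?w))\<^sup>2 = 2"
    using g by (simp add: plane_isometry_def dist_norm cmod_power2)
  ultimately show ?thesis by (rule opposite_corners_of_cell)
qed

lemma gaussian_unit_cases:
  assumes "cmod u = 1" "u = Complex (of_int a) (of_int b)"
  shows "u = 1 \<or> u = \<i> \<or> u = - 1 \<or> u = - \<i>"
proof -
  have "(of_int (a\<^sup>2 + b\<^sup>2) :: real) = of_int 1"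
    using assms cmod_power2[of u] by simp
  then have ab: "a\<^sup>2 + b\<^sup>2 = 1" by (simp only: of_int_eq_iff)
  then have "a\<^sup>2 \<le> 1" "b\<^sup>2 \<le> 1" using zero_le_power2[of a] zero_le_power2[of b] by linarith+
  then have "\<bar>a\<bar> \<le> 1" "\<bar>b\<bar> \<le> 1" by (auto simp: abs_square_le_1)
  then have "a \<in> {-1, 0, 1}" "b \<in> {-1, 0, 1}" by auto
  then show ?thesis using ab assms(2) by (auto simp: complex_eq_iff)
qed

text \<open>Records the action of \<open>g\<close> on the indices of cells and strands, so that
  statements about point sets can be replaced by integer ones.\<close>

definition carries ::
  "(complex \<Rightarrow> complex) \<Rightarrow> (int \<times> int \<Rightarrow> int \<times> int) \<Rightarrow> (strand \<Rightarrow> strand) \<Rightarrow> bool" where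
  "carries g \<phi> \<sigma> \<longleftrightarrow>
     plane_isometry g \<and> (\<forall>c. g ` cell c = cell (\<phi> c)) \<and> (\<forall>s. g ` region s = region (\<sigma> s))"

lemma mem_region_Warp: "z \<in> region (Warp i) \<longleftrightarrow> of_int i \<le> Re z \<and> Re z \<le> of_int i + 1"
proof
  assume "of_int i \<le> Re z \<and> Re z \<le> of_int i + 1"
  then have "z \<in> cell (i, \<lfloor>Im z\<rfloor>)" by (auto simp: cell_def)
  then show "z \<in> region (Warp i)" by auto
qed (auto simp: cell_def)

lemma mem_region_Weft: "z \<in> region (Weft j) \<longleftrightarrow> of_int j \<le> Im z \<and> Im z \<le> of_int j + 1"
proof
  assume "of_int j \<le> Im z \<and> Im z \<le> of_int j + 1"
  then have "z \<in> cell (\<lfloor>Re z\<rfloor>, j)" by (auto simp: cell_def)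
  then show "z \<in> region (Weft j)" by auto
qed (auto simp: cell_def)

declare region.simps [simp del]

lemma cell_eq_iff: "cell c = cell c' \<longleftrightarrow> c = c'"
proof
  assume eq: "cell c = cell c'"
  \<comment> \<open>Closed cells share boundary points; the centre lies in one cell only.\<close>
  have "Complex (of_int (fst c) + 1/2) (of_int (snd c) + 1/2) \<in> cell c"
    by (simp add: cell_def)
  then have "Complex (of_int (fst c) + 1/2) (of_int (snd c) + 1/2) \<in> cell c'"
    using eq by simp
  then show "c = c'"
    by (simp add: cell_def prod_eq_iff)
qed simp

lemma region_eq_iff: "region s = region s' \<longleftrightarrow> s = s'"
proof
  assume eq: "region s = region s'"
  have mem: "z \<in> region s \<longleftrightarrow> z \<in> region s'" for z using eq by simp
  show "s = s'"
  proof (cases s; cases s')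
    fix i i' assume "s = Warp i" "s' = Warp i'"
    then show ?thesis
      using mem[of "Complex (of_int i + 1/2) 0"] by (simp add: mem_region_Warp)
  next
    \<comment> \<open>The test point lies on the warp, and the offset 5 puts it clear of the
      weft.\<close>
    fix i j assume "s = Warp i" "s' = Weft j"
    then show ?thesis
      using mem[of "Complex (of_int i + 1/2) (of_int j + 5)"]
      by (simp add: mem_region_Warp mem_region_Weft)
  next
    fix i j assume "s = Weft j" "s' = Warp i"
    then show ?thesis
      using mem[of "Complex (of_int i + 1/2) (of_int j + 5)"]
      by (simp add: mem_region_Warp mem_region_Weft)
  next
    fix j j' assume "s = Weft j" "s' = Weft j'"
    then show ?thesis
      using mem[of "Complex 0 (of_int j + 1/2)"] by (simp add: mem_region_Weft)
  qed
qed simp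

lemma plane_isometry_comp: "plane_isometry g \<Longrightarrow> plane_isometry h \<Longrightarrow> plane_isometry (g \<circ> h)"
  unfolding plane_isometry_def by (metis comp_surj comp_apply)

lemma carries_comp:
  assumes "carries g \<phi> \<sigma>" "carries g' \<phi>' \<sigma>'"
  shows "carries (g \<circ> g') (\<phi> \<circ> \<phi>') (\<sigma> \<circ> \<sigma>')"
proof -
  have "plane_isometry (g \<circ> g')" using assms by (simp add: carries_def plane_isometry_comp)
  moreover have "(g \<circ> g') ` A = g ` g' ` A" for A by (rule image_comp[symmetric])
  ultimately show ?thesis using assms unfolding carries_def by (metis comp_apply)
qed

lemma image_eq_vimage_inverse:
  assumes "\<And>z. g (h z) = z" "\<And>z. h (g z) = z"
  shows "g ` A = {z. h z \<in> A}"
proof (intro equalityI subsetI)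
  fix z assume "z \<in> {z. h z \<in> A}"
  then have "g (h z) \<in> g ` A" by blast
  then show "z \<in> g ` A" by (simp add: assms)
qed (auto simp: assms)

lemma carries_translation:
  "carries (\<lambda>z. z + Complex (of_int a) (of_int b)) (\<lambda>(i, j). (i + a, j + b))
     (case_strand (\<lambda>i. Warp (i + a)) (\<lambda>j. Weft (j + b)))"
proof -
  let ?t = "Complex (of_int a) (of_int b)"
  have im: "(\<lambda>z. z + ?t) ` A = {z. z - ?t \<in> A}" for A
    by (rule image_eq_vimage_inverse) auto
  have "surj (\<lambda>z. z + ?t)" by (rule surjI[where f = "\<lambda>z. z - ?t"]) simp
  then show ?thesis
    unfolding carries_def plane_isometry_def im
    by (auto simp: cell_def mem_region_Warp mem_region_Weft dist_norm set_eq_iff split: strand.split)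
qed

text \<open>The \<open>- 1\<close> appears because cells are named after lower left corners, while
  the turn brings the upper left corner of a cell to that place.\<close>

lemma carries_turn:
  "carries (\<lambda>z. \<i> * z) (\<lambda>(i, j). (- j - 1, i)) (case_strand Weft (\<lambda>j. Warp (- j - 1)))"
proof -
  have im: "(\<lambda>z. \<i> * z) ` A = {z. - \<i> * z \<in> A}" for A
    by (rule image_eq_vimage_inverse) auto
  have "surj (\<lambda>z. \<i> * z)" by (rule surjI[where f = "\<lambda>z. - \<i> * z"]) simp
  moreover have "dist (\<i> * z) (\<i> * w) = dist z w" for z w
    by (simp add: dist_norm right_diff_distrib[symmetric] norm_mult)
  ultimately show ?thesis
    unfolding carries_def plane_isometry_def im
    by (auto simp: cell_def mem_region_Warp mem_region_Weft set_eq_iff split: strand.split)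
qed

lemma carries_quarter_turn:
  "carries (\<lambda>z. \<i> * z + Complex (of_int a) (of_int b)) (\<lambda>(i, j). (a - j - 1, b + i))
     (case_strand (\<lambda>i. Weft (b + i)) (\<lambda>j. Warp (a - j - 1)))"
    (is "carries ?g ?\<phi> ?\<sigma>")
proof -
  have "?g = (\<lambda>z. z + Complex (of_int a) (of_int b)) \<circ> (\<lambda>z. \<i> * z)"
    "?\<phi> = (\<lambda>(i, j). (i + a, j + b)) \<circ> (\<lambda>(i, j). (- j - 1, i))"
    "?\<sigma> = case_strand (\<lambda>i. Warp (i + a)) (\<lambda>j. Weft (j + b)) \<circ>
       case_strand Weft (\<lambda>j. Warp (- j - 1))"
    by (auto simp: fun_eq_iff split: strand.split)
  then show ?thesis by (metis carries_comp[OF carries_translation carries_turn])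
qed

lemma carries_half_turn:
  "carries (\<lambda>z. - z + Complex (of_int a) (of_int b)) (\<lambda>(i, j). (a - i - 1, b - j - 1))
     (case_strand (\<lambda>i. Warp (a - i - 1)) (\<lambda>j. Weft (b - j - 1)))"
    (is "carries ?g ?\<phi> ?\<sigma>")
proof -
  have "?g = (\<lambda>z. \<i> * z + Complex (of_int a) (of_int b)) \<circ> (\<lambda>z. \<i> * z)"
    "?\<phi> = (\<lambda>(i, j). (a - j - 1, b + i)) \<circ> (\<lambda>(i, j). (- j - 1, i))"
    "?\<sigma> = case_strand (\<lambda>i. Weft (b + i)) (\<lambda>j. Warp (a - j - 1)) \<circ>
       case_strand Weft (\<lambda>j. Warp (- j - 1))"
    by (auto simp: fun_eq_iff mult.assoc[symmetric] split: strand.split)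
  then show ?thesis by (metis carries_comp[OF carries_quarter_turn carries_turn])
qed

lemma carries_reverse_quarter_turn:
  "carries (\<lambda>z. - \<i> * z + Complex (of_int a) (of_int b)) (\<lambda>(i, j). (a + j, b - i - 1))
     (case_strand (\<lambda>i. Weft (b - i - 1)) (\<lambda>j. Warp (a + j)))"
    (is "carries ?g ?\<phi> ?\<sigma>")
proof -
  have "?g = (\<lambda>z. - z + Complex (of_int a) (of_int b)) \<circ> (\<lambda>z. \<i> * z)"
    "?\<phi> = (\<lambda>(i, j). (a - i - 1, b - j - 1)) \<circ> (\<lambda>(i, j). (- j - 1, i))"
    "?\<sigma> = case_strand (\<lambda>i. Warp (a - i - 1)) (\<lambda>j. Weft (b - j - 1)) \<circ>
       case_strand Weft (\<lambda>j. Warp (- j - 1))"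
    by (auto simp: fun_eq_iff split: strand.split)
  then show ?thesis by (metis carries_comp[OF carries_half_turn carries_turn])
qed

section \<open>Symmetries of the design as identities over the integers\<close>

definition translation_sym :: "prefabric \<Rightarrow> int \<Rightarrow> int \<Rightarrow> bool \<Rightarrow> bool" where
  "translation_sym P a b \<epsilon> \<longleftrightarrow> (\<forall>i j. P (i + a, j + b) = (P (i, j) \<noteq> \<epsilon>))"

text \<open>Here and for quarter-turns \<open>(a, b)\<close> is the image of the origin, not the
  centre, which is \<open>(a/2, b/2)\<close> for the half-turn.\<close>

definition half_turn_sym :: "prefabric \<Rightarrow> int \<Rightarrow> int \<Rightarrow> bool \<Rightarrow> bool" where
  "half_turn_sym P a b \<epsilon> \<longleftrightarrow> (\<forall>i j. P (a - i - 1, b - j - 1) = (P (i, j) \<noteq> \<epsilon>))"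

text \<open>A quarter-turn exchanges warps and wefts, so here it is the absence of \<open>\<tau>\<close> that negates
  the design.\<close>

definition quarter_turn_sym :: "prefabric \<Rightarrow> int \<Rightarrow> int \<Rightarrow> bool \<Rightarrow> bool" where
  "quarter_turn_sym P a b \<epsilon> \<longleftrightarrow> (\<forall>i j. P (a - j - 1, b + i) = (P (i, j) = \<epsilon>))"

lemma symmetries_iff:
  assumes "carries g \<phi> \<sigma>"
  shows "(g, \<epsilon>) \<in> symmetries P \<longleftrightarrow>
    (\<forall>c. \<sigma> (top_strand P c) = (if \<epsilon> then under_strand P (\<phi> c) else top_strand P (\<phi> c)))"
  using assms
  by (auto simp: symmetries_def carries_def cell_eq_iff region_eq_iff
      simp del: split_paired_All split_paired_Ex)

lemma translation_sym_iff:
  "(\<lambda>z. z + Complex (of_int a) (of_int b), \<epsilon>) \<in> symmetries P \<longleftrightarrow> translation_sym P a b \<epsilon>"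
  unfolding symmetries_iff[OF carries_translation]
  by (cases \<epsilon>) (auto simp: translation_sym_def top_strand_def under_strand_def)

lemma half_turn_sym_iff:
  "(\<lambda>z. - z + Complex (of_int a) (of_int b), \<epsilon>) \<in> symmetries P \<longleftrightarrow> half_turn_sym P a b \<epsilon>"
  unfolding symmetries_iff[OF carries_half_turn]
  by (cases \<epsilon>) (auto simp: half_turn_sym_def top_strand_def under_strand_def)

lemma quarter_turn_sym_iff:
  "(\<lambda>z. \<i> * z + Complex (of_int a) (of_int b), \<epsilon>) \<in> symmetries P \<longleftrightarrow> quarter_turn_sym P a b \<epsilon>"
  unfolding symmetries_iff[OF carries_quarter_turn]
  by (cases \<epsilon>) (auto simp: quarter_turn_sym_def top_strand_def under_strand_def)

text \<open>The inverse of a clockwise symmetry is an anticlockwise one; for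
  \<open>t = a + b \<i>\<close> its translation part is \<open>- \<i> t\<close>, that is
  \<open>(b, - a)\<close>.\<close>

lemma reverse_quarter_turn_sym:
  assumes "(\<lambda>z. - \<i> * z + Complex (of_int a) (of_int b), \<epsilon>) \<in> symmetries P"
  shows "quarter_turn_sym P b (- a) \<epsilon>"
proof -
  have *: "P (a + j, b - i - 1) = (P (i, j) = \<epsilon>)" for j i
    using assms[unfolded symmetries_iff[OF carries_reverse_quarter_turn]]
    by (auto simp: top_strand_def under_strand_def split: if_splits dest: spec[of _ "(i, j)"])
  have "P (b - j - 1, - a + i) = (P (i, j) = \<epsilon>)" for i j
    using *[of "i - a" "b - j - 1"] by auto
  then show ?thesis
    by (simp add: quarter_turn_sym_def)
qed

text \<open>With reflections and glides excluded, \<open>u = g 1 - g 0\<close> is a difference of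
  lattice points of modulus 1, hence a Gaussian unit.\<close>

lemma symmetry_cases:
  assumes g: "(g, \<epsilon>) \<in> symmetries P" and P: "non_exceptional P"
  obtains u a b where "u = 1 \<or> u = \<i> \<or> u = - 1 \<or> u = - \<i>"
    "g = (\<lambda>z. u * z + Complex (of_int a) (of_int b))"
proof -
  have iso: "plane_isometry g" and cell: "\<exists>c'. g ` cell c = cell c'" for c
    using g unfolding symmetries_def by blast+
  have nr: "\<not> reflection_or_glide g" using g P by (auto simp: non_exceptional_def)
  from iso show thesis
  proof (cases rule: plane_isometry_cases)
    case (1 u t)
    obtain a b where ab: "g 0 = Complex (of_int a) (of_int b)"
      using corner_image[OF iso cell, of 0 0] by (auto simp: zero_complex.code)
    obtain a' b' where ab': "g 1 = Complex (of_int a') (of_int b')"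
      using corner_image[OF iso cell, of 1 0] by (auto simp: one_complex.code)
    have "u = Complex (of_int (a' - a)) (of_int (b' - b))"
      using ab ab' 1(2) by (simp add: complex_eq_iff)
    then have "u = 1 \<or> u = \<i> \<or> u = - 1 \<or> u = - \<i>" by (rule gaussian_unit_cases[OF 1(1)])
    then show thesis using that 1(2) ab by auto
  next
    case (2 u t)
    then show thesis using nr reflection_or_glide_cnj by blast
  qed
qed

text \<open>Quarter-turns send warps to wefts, so only translations and half-turns can take one warp
  to another, and the two indices fix their horizontal part.\<close>

lemma isonemal_warps:
  assumes "isonemal P" "non_exceptional P"
  shows "(\<exists>b \<epsilon>. translation_sym P (i' - i) b \<epsilon>) \<or> (\<exists>b \<epsilon>. half_turn_sym P (i + i' + 1) b \<epsilon>)"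
proof -
  obtain g \<epsilon> where g: "(g, \<epsilon>) \<in> symmetries P" "g ` region (Warp i) = region (Warp i')"
    using assms(1) unfolding isonemal_def by blast
  obtain u a b where u: "u = 1 \<or> u = \<i> \<or> u = - 1 \<or> u = - \<i>"
    and gu: "g = (\<lambda>z. u * z + Complex (of_int a) (of_int b))"
    using symmetry_cases[OF g(1) assms(2)] by blast
  have carried: "\<sigma> (Warp i) = Warp i'" if "carries g \<phi> \<sigma>" for \<phi> \<sigma>
    using that g(2) by (simp add: carries_def region_eq_iff)
  from u show ?thesis
  proof (elim disjE)
    assume [simp]: "u = 1"
    have "translation_sym P a b \<epsilon>" using g(1) by (simp add: gu translation_sym_iff)
    moreover have "a = i' - i" using carried carries_translation[of a b] by (fastforce simp: gu)
    ultimately show ?thesis by blast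
  next
    assume [simp]: "u = - 1"
    have "half_turn_sym P a b \<epsilon>" using g(1) half_turn_sym_iff[of a b \<epsilon> P] by (simp add: gu)
    moreover have "a = i + i' + 1" using carried carries_half_turn[of a b] by (fastforce simp: gu)
    ultimately show ?thesis by blast
  next
    assume [simp]: "u = \<i>"
    show ?thesis using carried carries_quarter_turn[of a b] by (fastforce simp: gu)
  next
    assume [simp]: "u = - \<i>"
    show ?thesis using carried carries_reverse_quarter_turn[of a b] by (fastforce simp: gu)
  qed
qed

lemma ex_quarter_turn_sym:
  assumes "quarter_turn_symmetry P" "non_exceptional P"
  shows "\<exists>a b \<epsilon>. quarter_turn_sym P a b \<epsilon>"
proof -
  obtain g \<epsilon> where g: "(g, \<epsilon>) \<in> symmetries P" "quarter_turn g"
    using assms(1) unfolding quarter_turn_symmetry_def by blast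
  obtain u a b where u: "u = 1 \<or> u = \<i> \<or> u = - 1 \<or> u = - \<i>"
    and gu: "g = (\<lambda>z. u * z + Complex (of_int a) (of_int b))"
    using symmetry_cases[OF g(1) assms(2)] by blast
  have "g 1 - g 0 = \<i> \<or> g 1 - g 0 = - \<i>"
    using g(2) by (auto simp: quarter_turn_def rotation_def algebra_simps)
  then have "u = \<i> \<or> u = - \<i>" by (simp add: gu)
  then show ?thesis
    using g(1) quarter_turn_sym_iff reverse_quarter_turn_sym unfolding gu by blast
qed

section \<open>Composition of translations, half-turns and quarter-turns\<close>

lemma translation_sym_add:
  assumes "translation_sym P a b \<epsilon>" "translation_sym P c d \<delta>"
  shows "translation_sym P (a + c) (b + d) (\<epsilon> \<noteq> \<delta>)"
  using assms unfolding translation_sym_def by (auto simp: add.assoc[symmetric])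

lemma translation_sym_minus:
  assumes "translation_sym P a b \<epsilon>"
  shows "translation_sym P (- a) (- b) \<epsilon>"
  unfolding translation_sym_def
proof (intro allI)
  fix i j
  have "P (i - a + a, j - b + b) = (P (i - a, j - b) \<noteq> \<epsilon>)"
    using assms unfolding translation_sym_def by blast
  then show "P (i + - a, j + - b) = (P (i, j) \<noteq> \<epsilon>)" by auto
qed

lemma translation_sym_multiple:
  assumes "translation_sym P a b False"
  shows "translation_sym P (n * a) (n * b) False"
proof (induction n rule: int_induct[where k = 0])
  case base
  show ?case by (simp add: translation_sym_def)
next
  case (step1 n)
  then show ?case using translation_sym_add[OF step1(2) assms] by (simp add: algebra_simps)
next
  case (step2 n)
  then show ?case
    using translation_sym_add[OF step2(2) translation_sym_minus[OF assms]] by (simp add: algebra_simps)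
qed

text \<open>Conjugation by the quarter-turn multiplies the vector by \<open>\<i>\<close>;
  \<open>\<delta>\<close> enters twice and cancels.\<close>

lemma translation_sym_rotate:
  assumes Q: "quarter_turn_sym P p q \<delta>" and T: "translation_sym P a b \<epsilon>"
  shows "translation_sym P (- b) a \<epsilon>"
  unfolding translation_sym_def
proof (intro allI)
  fix i j
  have "P (p - (p - i - 1 + b) - 1, q + (j - q + a)) = (P (j - q + a, p - i - 1 + b) = \<delta>)"
    using Q unfolding quarter_turn_sym_def by blast
  moreover have "P (p - (p - i - 1) - 1, q + (j - q)) = (P (j - q, p - i - 1) = \<delta>)"
    using Q unfolding quarter_turn_sym_def by blast
  moreover have "P (j - q + a, p - i - 1 + b) = (P (j - q, p - i - 1) \<noteq> \<epsilon>)"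
    using T unfolding translation_sym_def by blast
  ultimately show "P (i + - b, j + a) = (P (i, j) \<noteq> \<epsilon>)"
    by auto
qed

lemma quarter_turn_sym_translate:
  assumes "quarter_turn_sym P p q \<delta>" "translation_sym P a b \<epsilon>"
  shows "quarter_turn_sym P (p + a) (q + b) (\<delta> \<noteq> \<epsilon>)"
  unfolding quarter_turn_sym_def
proof (intro allI)
  fix i j
  have "P (p - j - 1 + a, q + i + b) = (P (p - j - 1, q + i) \<noteq> \<epsilon>)"
    using assms(2) unfolding translation_sym_def by blast
  moreover have "P (p - j - 1, q + i) = (P (i, j) = \<delta>)"
    using assms(1) unfolding quarter_turn_sym_def by blast
  ultimately show "P (p + a - j - 1, q + b + i) = (P (i, j) = (\<delta> \<noteq> \<epsilon>))"
    by (auto simp: algebra_simps)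
qed

text \<open>This is the square of the quarter-turn, so it preserves the sides for either value of
  \<open>\<delta>\<close>.\<close>

lemma half_turn_sym_of_quarter_turn:
  assumes "quarter_turn_sym P p q \<delta>"
  shows "half_turn_sym P (p - q) (p + q) False"
  unfolding half_turn_sym_def
proof (intro allI)
  fix i j
  have "P (p - (q + i) - 1, q + (p - j - 1)) = (P (p - j - 1, q + i) = \<delta>)"
    using assms unfolding quarter_turn_sym_def by blast
  moreover have "P (p - j - 1, q + i) = (P (i, j) = \<delta>)"
    using assms unfolding quarter_turn_sym_def by blast
  ultimately show "P (p - q - i - 1, p + q - j - 1) = (P (i, j) \<noteq> False)"
    by (auto simp: algebra_simps)
qed

lemma translation_sym_of_half_turns:
  assumes "half_turn_sym P a b \<epsilon>" "half_turn_sym P c d \<delta>"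
  shows "translation_sym P (a - c) (b - d) (\<epsilon> \<noteq> \<delta>)"
  unfolding translation_sym_def
proof (intro allI)
  fix i j
  have "P (a - (c - i - 1) - 1, b - (d - j - 1) - 1) = (P (c - i - 1, d - j - 1) \<noteq> \<epsilon>)"
    using assms(1) unfolding half_turn_sym_def by blast
  moreover have "P (c - i - 1, d - j - 1) = (P (i, j) \<noteq> \<delta>)"
    using assms(2) unfolding half_turn_sym_def by blast
  ultimately show "P (i + (a - c), j + (b - d)) = (P (i, j) \<noteq> (\<epsilon> \<noteq> \<delta>))"
    by (auto simp: algebra_simps)
qed

text \<open>Composing with the square of the quarter-turn turns each half-turn into a
  translation.\<close>

lemma warp_transitivity:
  assumes "isonemal P" "non_exceptional P" "quarter_turn_sym P p q \<delta>"
  shows "(\<exists>b \<epsilon>. translation_sym P (i' - i) b \<epsilon>) \<or>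
    (\<exists>b \<epsilon>. translation_sym P (i + i' + 1 - (p - q)) b \<epsilon>)"
  using isonemal_warps[OF assms(1,2)]
    translation_sym_of_half_turns[OF _ half_turn_sym_of_quarter_turn[OF assms(3)]] by blast

section \<open>Cuts\<close>

text \<open>\<open>\<alpha>\<close> and \<open>\<beta>\<close> select the warps and the wefts that belong to the upper part.\<close>

definition cut :: "prefabric \<Rightarrow> (int \<Rightarrow> bool) \<Rightarrow> (int \<Rightarrow> bool) \<Rightarrow> bool" where
  "cut P \<alpha> \<beta> \<longleftrightarrow>
     (\<forall>i j. (\<alpha> i \<and> \<not> \<beta> j \<longrightarrow> P (i, j)) \<and> (\<not> \<alpha> i \<and> \<beta> j \<longrightarrow> \<not> P (i, j)))"

lemma falls_apart_cut:
  assumes "falls_apart P"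
  obtains \<alpha> \<beta> where "cut P \<alpha> \<beta>" "(\<exists>i. \<alpha> i) \<or> (\<exists>j. \<beta> j)" "(\<exists>i. \<not> \<alpha> i) \<or> (\<exists>j. \<not> \<beta> j)"
proof -
  obtain A B where AB: "A \<noteq> {}" "B \<noteq> {}" "A \<inter> B = {}" "A \<union> B = UNIV"
    and "\<forall>c. \<forall>s \<in> A \<inter> strands_at c. \<forall>t \<in> B \<inter> strands_at c. top_strand P c = s"
    using assms unfolding falls_apart_def by (elim exE conjE)
  then have over: "s \<in> A \<inter> strands_at c \<Longrightarrow> t \<in> B \<inter> strands_at c \<Longrightarrow> top_strand P c = s" for c s t
    by blast
  have B: "s \<in> B \<longleftrightarrow> s \<notin> A" for s using AB by blast
  let ?\<alpha> = "\<lambda>i. Warp i \<in> A" and ?\<beta> = "\<lambda>j. Weft j \<in> A"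
  have "P (i, j)" if "Warp i \<in> A" "Weft j \<notin> A" for i j
    using over[of "Warp i" "(i, j)" "Weft j"] that B
    by (simp add: strands_at_def top_strand_def split: if_splits)
  moreover have "\<not> P (i, j)" if "Warp i \<notin> A" "Weft j \<in> A" for i j
    using over[of "Weft j" "(i, j)" "Warp i"] that B
    by (simp add: strands_at_def top_strand_def split: if_splits)
  ultimately have "cut P ?\<alpha> ?\<beta>" by (simp add: cut_def)
  moreover have "(\<exists>i. ?\<alpha> i) \<or> (\<exists>j. ?\<beta> j)" using AB(1) by (metis ex_in_conv strand.exhaust)
  moreover have "(\<exists>i. \<not> ?\<alpha> i) \<or> (\<exists>j. \<not> ?\<beta> j)" using AB(2) B by (metis ex_in_conv strand.exhaust)
  ultimately show thesis by (rule that)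
qed

text \<open>A strand and its images under the powers of a side-preserving quarter-turn cross cyclically,
  each over the next or each under the next, so no cut separates them.\<close>

lemma cut_quarter_turn:
  assumes P: "cut P \<alpha> \<beta>" and Q: "quarter_turn_sym P a b False"
  shows "\<beta> (b + i) = \<alpha> i" "\<alpha> (a - b - i - 1) = \<alpha> i" "\<beta> j = \<alpha> (a - j - 1)"
proof -
  have turn: "P (a - j - 1, b + i) \<longleftrightarrow> \<not> P (i, j)" for i j
    using Q by (simp add: quarter_turn_sym_def)
  have c: "\<alpha> i \<Longrightarrow> \<not> \<beta> j \<Longrightarrow> P (i, j)" "\<not> \<alpha> i \<Longrightarrow> \<beta> j \<Longrightarrow> \<not> P (i, j)" for i j
    using P by (auto simp: cut_def)
  have *: "\<beta> (b + i) = \<alpha> i \<and> \<alpha> (a - b - i - 1) = \<alpha> i \<and> \<beta> (a - i - 1) = \<alpha> i" for i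
  proof -
    \<comment> \<open>The orbit of \<open>Warp i\<close> is \<open>Warp i\<close>,
      \<open>Weft (b + i)\<close>, \<open>Warp ?k\<close>, \<open>Weft ?l\<close>; the equations
      below make its four crossings cyclic.\<close>
    let ?k = "a - b - i - 1" and ?l = "a - i - 1"
    have "P (?k, b + i) = (\<not> P (i, b + i))" "P (?k, ?l) = (\<not> P (?k, b + i))"
      "P (i, ?l) = (\<not> P (?k, ?l))"
      using turn[of "b + i" i] turn[of "b + i" ?k] turn[of ?l ?k]
      by (simp_all add: algebra_simps)
    then show ?thesis
      using c[of i "b + i"] c[of ?k "b + i"] c[of ?k ?l] c[of i ?l] by blast
  qed
  show "\<beta> (b + i) = \<alpha> i" "\<alpha> (a - b - i - 1) = \<alpha> i" using * by auto
  show "\<beta> j = \<alpha> (a - j - 1)" using *[of "a - j - 1"] by simp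
qed

text \<open>For odd \<open>a - b\<close> the turn is about the centre of a cell. That cell is fixed
  while its two strands are exchanged, which forces a reversal of sides.\<close>

lemma even_quarter_turn_sym:
  assumes "quarter_turn_sym P a b False"
  shows "even (a - b)"
proof (rule ccontr)
  assume "odd (a - b)"
  then obtain k where "a - b = 2 * k + 1" by (rule oddE)
  then have "a - (b + k) - 1 = k" by simp
  then have "P (k, b + k) = (P (k, b + k) = False)"
    using assms unfolding quarter_turn_sym_def by metis
  then show False by simp
qed

lemma carries_cnj:
  "carries cnj (\<lambda>(i, j). (i, - j - 1)) (case_strand Warp (\<lambda>j. Weft (- j - 1)))"
proof -
  have im: "cnj ` A = {z. cnj z \<in> A}" for A
    by (rule image_eq_vimage_inverse) auto
  have "surj cnj" by (rule surjI[where f = cnj]) simp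
  moreover have "dist (cnj z) (cnj w) = dist z w" for z w
    by (simp add: dist_norm complex_cnj_diff[symmetric] del: complex_cnj_diff)
  ultimately show ?thesis
    unfolding carries_def plane_isometry_def im
    by (auto simp: cell_def mem_region_Warp mem_region_Weft set_eq_iff split: strand.split)
qed

text \<open>A constant design is invariant under the reflection \<open>cnj\<close>.\<close>

lemma not_constant:
  assumes "non_exceptional P"
  obtains i j where "P (i, j) \<noteq> v"
proof (rule ccontr)
  assume "\<not> thesis"
  then have "P c = v" for c using that by (cases c) auto
  then have "(cnj, False) \<in> symmetries P"
    by (auto simp: symmetries_iff[OF carries_cnj] top_strand_def split: strand.split)
  moreover have "reflection_or_glide cnj" using reflection_or_glide_cnj[of 1 0] by simp
  ultimately show False using assms unfolding non_exceptional_def by blast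
qed

text \<open>If \<open>t = a + b \<i>\<close> is a period, so is \<open>\<i> t\<close>, and
  \<open>a\<close> times the latter plus \<open>b\<close> times \<open>t\<close> is vertical of
  length \<open>a * a + b * b\<close>.\<close>

lemma ex_vertical_period:
  assumes "periodic P" and Q: "quarter_turn_sym P p q \<delta>"
  obtains N where "N > 0" "translation_sym P 0 N False"
proof -
  obtain a b a' b' :: int
    where ind: "independent {Complex (of_int a) (of_int b), Complex (of_int a') (of_int b')}"
      and ab: "\<forall>i j. P (i + a, j + b) = P (i, j)"
    using assms(1) unfolding periodic_def by blast
  have T: "translation_sym P a b False" using ab by (simp add: translation_sym_def)
  have "Complex (of_int a) (of_int b) \<noteq> 0"
    using ind dependent_zero by (metis insertI1)
  then have "a \<noteq> 0 \<or> b \<noteq> 0" by (auto simp: zero_complex.code)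
  then have "a * a + b * b > 0"
    by (metis sum_squares_gt_zero_iff)
  moreover have "translation_sym P 0 (a * a + b * b) False"
    using translation_sym_add[OF translation_sym_multiple[OF translation_sym_rotate[OF Q T], of a]
        translation_sym_multiple[OF T, of b]]
    by (simp add: algebra_simps)
  ultimately show thesis using that by blast
qed

text \<open>Iterating the domination through a whole period leads back to the column it started from.\<close>

lemma dominated_column_eq:
  assumes N: "N > 0" "translation_sym P 0 N False"
    and sym: "translation_sym P (i' - i) y False \<or> half_turn_sym P (i + i' + 1) y False"
    and dom: "\<And>j. P (i', j) \<Longrightarrow> P (i, j)"
  shows "P (i', j) = P (i, j)"
  using sym
proof
  assume T: "translation_sym P (i' - i) y False"
  have shift: "P (i', j + y) = P (i, j)" for j
  proof -
    have "P (i + (i' - i), j + y) = (P (i, j) \<noteq> False)"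
      using T unfolding translation_sym_def by blast
    then show ?thesis by simp
  qed
  have up: "P (i, j + int n * y)" if "P (i, j)" for j n
  proof (induction n)
    case (Suc n)
    then have "P (i, j + int n * y + y)" using shift[of "j + int n * y"] dom by blast
    then show ?case by (simp add: algebra_simps)
  qed (use that in simp)
  have "P (i', j)" if "P (i, j)"
  proof -
    \<comment> \<open>Modulo the vertical period, \<open>N - 1\<close> steps of \<open>y\<close>
      amount to one step of \<open>- y\<close>.\<close>
    have "P (i, j + int (nat (N - 1)) * y)" by (rule up) (rule that)
    moreover have "j + int (nat (N - 1)) * y = j - y + y * N" using N(1) by (simp add: algebra_simps)
    moreover have "P (i, j - y + y * N) = P (i, j - y)"
      using translation_sym_multiple[OF N(2), of y] unfolding translation_sym_def
      by (metis add.right_neutral mult_zero_right)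
    ultimately have "P (i, j - y)" by (simp only:)
    then show ?thesis using shift[of "j - y"] by simp
  qed
  then show ?thesis using dom by blast
next
  assume H: "half_turn_sym P (i + i' + 1) y False"
  \<comment> \<open>The half-turn exchanges the two columns, and \<open>j\<close> with
    \<open>y - j - 1\<close>; using it twice with the domination in between closes the loop.\<close>
  have "P (i + i' + 1 - i - 1, y - j - 1) = (P (i, j) \<noteq> False)" for j
    using H unfolding half_turn_sym_def by blast
  then have "P (i', y - j - 1) = P (i, j)" for j by simp
  from this[of j] this[of "y - j - 1"] show ?thesis using dom by auto
qed

text \<open>If every quarter-turn reverses the sides, then all other symmetries preserve them, so the
  columns and the rows of the design are all congruent; a cut then forces the design to be constant.\<close>

lemma ex_side_preserving_quarter_turn:
  assumes "periodic P" "isonemal P" "non_exceptional P" "falls_apart P"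
    and Q: "quarter_turn_sym P p q \<delta>"
  obtains a b where "quarter_turn_sym P a b False"
proof (rule ccontr)
  assume "\<not> thesis"
  then have none: "\<not> quarter_turn_sym P a b False" for a b using that by blast
  have \<delta>: "\<delta>" using Q none by (cases \<delta>) auto
  \<comment> \<open>Composed with the reversing quarter-turn, a reversing translation would give a
    side-preserving quarter-turn.\<close>
  have T: "\<not> \<epsilon>" if "translation_sym P a b \<epsilon>" for a b \<epsilon>
    using quarter_turn_sym_translate[OF Q that] none \<delta> by auto
  have H: "\<not> \<epsilon>" if "half_turn_sym P a b \<epsilon>" for a b \<epsilon>
    using translation_sym_of_half_turns[OF that half_turn_sym_of_quarter_turn[OF Q]] T by auto
  have trans: "\<exists>y. translation_sym P (i' - i) y False \<or> half_turn_sym P (i + i' + 1) y False" for i i'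
    using isonemal_warps[OF assms(2,3), of i' i] T H by (metis (full_types))
  have turn: "P (p - j - 1, q + i) = P (i, j)" for i j
    using Q \<delta> by (auto simp: quarter_turn_sym_def)
  obtain N where N: "N > 0" "translation_sym P 0 N False"
    using ex_vertical_period[OF assms(1) Q] by blast
  obtain \<alpha> \<beta> where cut: "cut P \<alpha> \<beta>"
    and upper: "(\<exists>i. \<alpha> i) \<or> (\<exists>j. \<beta> j)" and lower: "(\<exists>i. \<not> \<alpha> i) \<or> (\<exists>j. \<not> \<beta> j)"
    using falls_apart_cut[OF assms(4)] by blast
  \<comment> \<open>The turn makes a constant row into a constant column, and all columns are
    congruent to it.\<close>
  have full_row: False if row: "\<And>i. P (i, l) = v" for l v
  proof -
    define k where "k = p - l - 1"
    have col: "P (k, j) = v" for j using turn[of l "j - q"] row[of "j - q"] by (simp add: k_def)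
    have "P (i, j) = v" for i j
    proof -
      obtain y where "translation_sym P (i - k) y False \<or> half_turn_sym P (k + i + 1) y False"
        using trans by blast
      then show ?thesis
      proof
        assume "translation_sym P (i - k) y False"
        then have "P (k + (i - k), j - y + y) = (P (k, j - y) \<noteq> False)"
          unfolding translation_sym_def by blast
        then show ?thesis using col by simp
      next
        assume "half_turn_sym P (k + i + 1) y False"
        then have "P (k + i + 1 - k - 1, y - (y - j - 1) - 1) = (P (k, y - j - 1) \<noteq> False)"
          unfolding half_turn_sym_def by blast
        then show ?thesis using col by simp
      qed
    qed
    then show False using not_constant[OF assms(3)] by metis
  qed
  show False
  proof (cases "\<exists>i i'. \<alpha> i \<and> \<not> \<alpha> i'")
    case True
    then obtain k k' where k: "\<alpha> k" "\<not> \<alpha> k'" by blast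
    \<comment> \<open>Column \<open>i\<close> of the upper part dominates column \<open>i'\<close>
      of the lower part, so they agree; one of them is prescribed by the cut in each row. Thus every
      row is constant.\<close>
    have P: "P (i, j) = (\<not> \<beta> j)" "P (i', j) = (\<not> \<beta> j)" if "\<alpha> i" "\<not> \<alpha> i'" for i i' j
    proof -
      obtain y where "translation_sym P (i' - i) y False \<or> half_turn_sym P (i + i' + 1) y False"
        using trans by blast
      then have "P (i', j) = P (i, j)" for j
        by (rule dominated_column_eq[OF N]) (use cut that in \<open>auto simp: cut_def\<close>)
      then show "P (i, j) = (\<not> \<beta> j)" "P (i', j) = (\<not> \<beta> j)"
        using cut that unfolding cut_def by blast+
    qed
    then have "P (i, j) = (\<not> \<beta> j)" for i j using k by (cases "\<alpha> i") blast+
    then show False by (rule full_row)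
  next
    \<comment> \<open>All warps lie in one part, so a weft of the other part is a constant
      row.\<close>
    case False
    then consider j where "\<And>i. \<alpha> i" "\<not> \<beta> j" | j where "\<And>i. \<not> \<alpha> i" "\<beta> j"
      using upper lower by blast
    then show False
    proof cases
      case (1 j)
      then have "P (i, j) = True" for i using cut by (simp add: cut_def)
      then show False by (rule full_row)
    next
      case (2 j)
      then have "P (i, j) = False" for i using cut by (simp add: cut_def)
      then show False by (rule full_row)
    qed
  qed
qed

text \<open>The quarter-turns with and without the translation both relate \<open>\<alpha>\<close>
  to \<open>\<beta>\<close>; comparing the two relations gives the periods.\<close>

lemma cut_translation_preserving:
  assumes cut: "cut P \<alpha> \<beta>" and Q: "quarter_turn_sym P p q False"
    and T: "translation_sym P x y False"
  shows "\<alpha> (i + x) = \<alpha> i" "\<beta> (j + y) = \<beta> j"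
proof -
  have Q': "quarter_turn_sym P (p + x) (q + y) False"
    using quarter_turn_sym_translate[OF Q T] by simp
  note turn = cut_quarter_turn[OF cut Q] and turn' = cut_quarter_turn[OF cut Q']
  show "\<alpha> (i + x) = \<alpha> i"
    using turn(3)[of "p - i - 1"] turn'(3)[of "p - i - 1"] by (simp add: algebra_simps)
  show "\<beta> (j + y) = \<beta> j"
    using turn(1)[of "j - q"] turn'(1)[of "j - q"] by (simp add: algebra_simps)
qed

text \<open>The side-preserving symmetries preserve the cut. If one that reverses the sides fixed the
  part of a single strand, transitivity would put all strands into that part.\<close>

lemma cut_translation_reversing:
  assumes P: "isonemal P" "non_exceptional P"
    and cut: "cut P \<alpha> \<beta>" "(\<exists>i. \<alpha> i) \<or> (\<exists>j. \<beta> j)" "(\<exists>i. \<not> \<alpha> i) \<or> (\<exists>j. \<not> \<beta> j)"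
    and Q: "quarter_turn_sym P p q False"
    and T: "translation_sym P x y True"
  shows "\<alpha> (i + x) = (\<not> \<alpha> i)"
proof (rule ccontr)
  assume "\<alpha> (i + x) \<noteq> (\<not> \<alpha> i)"
  then have i: "\<alpha> (i + x) = \<alpha> i" by blast
  note turn = cut_quarter_turn[OF cut(1) Q]
  note preserving = cut_translation_preserving(1)[OF cut(1) Q]
  \<comment> \<open>A reversing translation differs from \<open>T\<close> by a preserving one, so if
    \<open>T\<close> keeps the part of \<open>l\<close>, all translations do.\<close>
  have reach: "\<alpha> (l + u) = \<alpha> l" if "translation_sym P u v \<epsilon>" "\<alpha> (l + x) = \<alpha> l" for u v \<epsilon> l
  proof (cases \<epsilon>)
    case True
    then have "translation_sym P (u + - x) (v + - y) False"
      using translation_sym_add[OF that(1) translation_sym_minus[OF T]] by simp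
    then have "\<alpha> (l + x + (u + - x)) = \<alpha> (l + x)" by (rule preserving)
    then show ?thesis using that(2) by simp
  next
    case False
    then show ?thesis using preserving[of u v] that(1) by simp
  qed
  \<comment> \<open>The half-turn image of \<open>i\<close>: the second alternative of transitivity
    reaches \<open>i'\<close> by a translation starting here.\<close>
  define l where "l = p - q - i - 1"
  have l: "\<alpha> l = \<alpha> i" using turn(2)[of i] by (simp add: l_def)
  have "\<alpha> (l + x) = \<alpha> (i - x)" using turn(2)[of "i - x"] by (simp add: l_def algebra_simps)
  also have "\<dots> = \<alpha> (i - x + (x + x))"
    using preserving[of "x + x" "y + y" "i - x"] translation_sym_add[OF T T] by simp
  also have "i - x + (x + x) = i + x" by simp
  also have "\<alpha> (i + x) = \<alpha> l" using i l by simp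
  finally have lx: "\<alpha> (l + x) = \<alpha> l" .
  have "\<alpha> i' = \<alpha> i" for i'
    using warp_transitivity[OF P Q, of i' i]
  proof (elim disjE exE)
    fix b \<epsilon> assume "translation_sym P (i' - i) b \<epsilon>"
    from reach[OF this i] show ?thesis by simp
  next
    fix b \<epsilon> assume "translation_sym P (i + i' + 1 - (p - q)) b \<epsilon>"
    from reach[OF this lx] show ?thesis using l by (simp add: l_def algebra_simps)
  qed
  moreover have "\<beta> j = \<alpha> (p - j - 1)" for j by (rule turn)
  ultimately show False using cut(2,3) by metis
qed

section \<open>Antiperiodic sequences and thick stripes\<close>

lemma constant_of_period_1:
  fixes \<alpha> :: "int \<Rightarrow> bool"
  assumes "\<And>i. \<alpha> (i + 1) = \<alpha> i"
  shows "\<alpha> i = \<alpha> 0"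
  by (induction i rule: int_induct[where k = 0]) (use assms assms[of "_ - 1"] in auto)

lemma antiperiodic_shift:
  fixes \<alpha> :: "int \<Rightarrow> bool"
  assumes "\<And>i. \<alpha> (i + 2) = (\<not> \<alpha> i)"
  shows "\<alpha> (i + 2 * k) = (\<alpha> i \<noteq> odd k)"
proof (induction k rule: int_induct[where k = 0])
  case (step1 k)
  then show ?case using assms[of "i + 2 * k"] by (simp add: algebra_simps)
next
  case (step2 k)
  then show ?case using assms[of "i + 2 * (k - 1)"] by (simp add: algebra_simps)
qed simp

text \<open>The values run through x, y, not x, not y cyclically, so two cyclically adjacent ones
  are true; \<open>m\<close> is the first of such a pair.\<close>

lemma antiperiodic_thick:
  fixes \<alpha> :: "int \<Rightarrow> bool"
  assumes "\<And>i. \<alpha> (i + 2) = (\<not> \<alpha> i)"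
  obtains m where "\<And>i. \<alpha> i \<longleftrightarrow> (i - m) mod 4 < 2"
proof -
  have "\<exists>m. \<alpha> m \<and> \<alpha> (m + 1)"
    using assms[of 0] assms[of 1] assms[of 2]
    by (cases "\<alpha> 0"; cases "\<alpha> 1")
      (auto intro: exI[of _ 0] exI[of _ 1] exI[of _ 2] exI[of _ 3])
  then obtain m where m: "\<alpha> m" "\<alpha> (m + 1)" by blast
  have "\<alpha> i \<longleftrightarrow> (i - m) mod 4 < 2" for i
  proof -
    define r where "r = (i - m) mod 4"
    have "i = m + r + 2 * (2 * ((i - m) div 4))"
      using mult_div_mod_eq[of 4 "i - m"] by (simp add: r_def)
    then have "\<alpha> i = \<alpha> (m + r)" using antiperiodic_shift[of \<alpha>, OF assms, of "m + r"] by (metis dvd_triv_left)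
    moreover have "r \<in> {0, 1, 2, 3}" unfolding r_def by auto
    moreover have "\<not> \<alpha> (m + 2)" "\<not> \<alpha> (m + 3)" using assms[of m] assms[of "m + 1", unfolded add.assoc] m by auto
    ultimately show ?thesis using m by (auto simp: r_def[symmetric])
  qed
  then show thesis using that by blast
qed

text \<open>Warp 0 cannot reach warps 1 and -1 by translations, so half-turns take it there; the
  translations obtained from them differ by one with horizontal part 2.\<close>

lemma thick_cut:
  assumes P: "isonemal P" "non_exceptional P"
    and cut: "cut P \<alpha> \<beta>" "(\<exists>i. \<alpha> i) \<or> (\<exists>j. \<beta> j)" "(\<exists>i. \<not> \<alpha> i) \<or> (\<exists>j. \<not> \<beta> j)"
    and Q: "quarter_turn_sym P p q False"
  obtains n where "translation_sym P 2 (2 * n) True" "odd n" "\<And>i. \<alpha> (i + 2) = (\<not> \<alpha> i)"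
proof -
  note turn = cut_quarter_turn[OF cut(1) Q]
  note preserving = cut_translation_preserving(1)[OF cut(1) Q]
  note reversing = cut_translation_reversing[OF P cut Q]
  \<comment> \<open>The second equation uses the rotated translation, whose horizontal part is
    \<open>- y\<close>.\<close>
  have sym: "\<alpha> (i + x) = (\<alpha> i \<noteq> \<epsilon>)" "\<alpha> (i - y) = (\<alpha> i \<noteq> \<epsilon>)"
    if T: "translation_sym P x y \<epsilon>" for i x y \<epsilon>
    using preserving[of x y] reversing[of x y] preserving[of "- y" x] reversing[of "- y" x]
      T translation_sym_rotate[OF Q T]
    by (cases \<epsilon>; simp)+
  obtain k where k: "p - q = 2 * k" using even_quarter_turn_sym[OF Q] by blast
  have flip: "\<alpha> (2 * k - i - 1) = \<alpha> i" for i using turn(2)[of i] k by simp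
  have not_1_periodic: False if "\<And>i. \<alpha> (i + 1) = \<alpha> i"
  proof -
    have "\<alpha> i = \<alpha> 0" for i using that by (rule constant_of_period_1)
    then show False using turn(3) cut(2,3) by metis
  qed
  \<comment> \<open>\<open>flip\<close> gives warps \<open>k - 1\<close> and \<open>k\<close> the
    same part, which excludes a reversing unit shift; a preserving one would make
    \<open>\<alpha>\<close> constant.\<close>
  have no1: "\<not> translation_sym P 1 y \<epsilon>" for y \<epsilon>
  proof
    assume T: "translation_sym P 1 y \<epsilon>"
    have "\<alpha> (k - 1 + 1) = \<alpha> (k - 1)" using flip[of k] by simp
    then have "\<not> \<epsilon>" using sym(1)[OF T, of "k - 1"] by auto
    then show False using sym(1)[OF T] not_1_periodic by blast
  qed
  have no1': "\<not> translation_sym P (- 1) y \<epsilon>" for y \<epsilon>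
    using translation_sym_minus[of P "- 1" y \<epsilon>] no1 by auto
  obtain y1 \<epsilon>1 where "translation_sym P (2 - 2 * k) y1 \<epsilon>1"
    using warp_transitivity[OF P Q, of 1 0] no1 k by auto
  moreover obtain y2 \<epsilon>2 where "translation_sym P (- 2 * k) y2 \<epsilon>2"
    using warp_transitivity[OF P Q, of "- 1" 0] no1' k by auto
  ultimately have "\<exists>y \<epsilon>. translation_sym P (2 - 2 * k + - (- 2 * k)) y \<epsilon>"
    using translation_sym_add translation_sym_minus by blast
  then obtain y \<epsilon> where T: "translation_sym P 2 y \<epsilon>" by auto
  \<comment> \<open>Otherwise even shifts preserve \<open>\<alpha>\<close>, and \<open>flip\<close>,
    which changes the parity of the index, would yield period 1.\<close>
  have \<epsilon>
  proof (rule ccontr)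
    assume "\<not> \<epsilon>"
    then have per: "\<alpha> (i + 2 * l) = \<alpha> i" for i l
      using preserving[of "2 * l" "y * l" i] translation_sym_multiple[of P 2 y l] T
      by (simp add: mult.commute)
    have "\<alpha> (i + 1) = \<alpha> i" for i
      using flip[of i] per[of "i + 1" "k - i - 1"] by (simp add: algebra_simps)
    then show False by (rule not_1_periodic)
  qed
  then have T: "translation_sym P 2 y True" using T by simp
  have anti: "\<alpha> (i + 2) = (\<not> \<alpha> i)" for i using sym(1)[OF T] by simp
  have y: "\<alpha> (i - y) = (\<not> \<alpha> i)" for i using sym(2)[OF T] by simp
  \<comment> \<open>Two shifts by \<open>y\<close> restore \<open>\<alpha>\<close>, whereas
    \<open>y\<close> shifts by 2 would negate it for odd \<open>y\<close>.\<close>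
  have "even y"
  proof (rule ccontr)
    assume "odd y"
    then have "\<alpha> (- 2 * y + 2 * y) = (\<not> \<alpha> (- 2 * y))"
      using antiperiodic_shift[of \<alpha>, OF anti, of "- 2 * y" y] by simp
    then show False using y[of 0] y[of "- y"] by simp
  qed
  then obtain n where n: "y = 2 * n" by blast
  have "odd n" using antiperiodic_shift[of \<alpha>, OF anti, of "- y" n] y[of 0] n by auto
  then show thesis using that T anti n by blast
qed

section \<open>The fabric\<close>

text \<open>With dark warps and pale wefts in the upper part, a cut determines the fabric on the cells
  where both strands lie in the same part. The plain weave is invariant enough to serve on the others,
  where the two strands have the same colour.\<close>

definition weave :: "prefabric \<Rightarrow> (int \<Rightarrow> bool) \<Rightarrow> (int \<Rightarrow> bool) \<Rightarrow> prefabric" where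
  "weave P \<alpha> \<beta> = (\<lambda>(i, j).
     if \<alpha> i \<and> \<beta> j then P (i, j) else if \<not> \<alpha> i \<and> \<not> \<beta> j then \<not> P (i, j) else even (i + j))"

text \<open>Where the parts differ, both strands have one colour, and it is the colour that the cut
  prescribes for \<open>P\<close>.\<close>

lemma pattern_weave:
  assumes "cut P \<alpha> \<beta>"
  shows "pattern (weave P \<alpha> \<beta>) (case_strand \<alpha> (\<lambda>j. \<not> \<beta> j)) = P"
  using assms by (auto simp: pattern_def top_strand_def weave_def cut_def fun_eq_iff)

text \<open>The turn preserves the parts and, since \<open>p - q\<close> is even, swaps the two
  parities of cells, as the plain weave requires.\<close>

lemma weave_quarter_turn_sym:
  assumes "cut P \<alpha> \<beta>" and Q: "quarter_turn_sym P p q False"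
  shows "quarter_turn_sym (weave P \<alpha> \<beta>) p q False"
proof -
  have "even (p - q)" by (rule even_quarter_turn_sym[OF Q])
  then have par: "even (p - j - 1 + (q + i)) = odd (i + j)" for i j by presburger
  have "P (p - j - 1, q + i) = (\<not> P (i, j))" for i j
    using Q by (simp add: quarter_turn_sym_def)
  then show ?thesis
    using cut_quarter_turn[OF assms] par by (auto simp: quarter_turn_sym_def weave_def)
qed

text \<open>Exchanging the parts interchanges the clauses \<open>P\<close> and
  \<open>\<not> P\<close>, which cancels the reversal of sides.\<close>

lemma weave_translation_sym:
  assumes T: "translation_sym P x y True" and "even (x + y)"
    and "\<And>i. \<alpha> (i + x) = (\<not> \<alpha> i)" "\<And>j. \<beta> (j + y) = (\<not> \<beta> j)"
  shows "translation_sym (weave P \<alpha> \<beta>) x y False"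
proof -
  have "P (i + x, j + y) = (\<not> P (i, j))" for i j
    using T by (simp add: translation_sym_def)
  moreover have "even (i + x + (j + y)) = even (i + j)" for i j using assms(2) by presburger
  ultimately show ?thesis using assms(3,4) by (auto simp: translation_sym_def weave_def)
qed

text \<open>For any cut, \<open>\<alpha>\<close> has period 2 and is invariant under a half-turn
  that changes parity, so all strands fall into one part.\<close>

lemma not_falls_apart:
  assumes Q: "quarter_turn_sym F p q False" and T: "translation_sym F 2 y False"
  shows "\<not> falls_apart F"
proof
  assume "falls_apart F"
  then obtain \<alpha> \<beta> where cut: "cut F \<alpha> \<beta>"
    "(\<exists>i. \<alpha> i) \<or> (\<exists>j. \<beta> j)" "(\<exists>i. \<not> \<alpha> i) \<or> (\<exists>j. \<not> \<beta> j)"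
    by (rule falls_apart_cut)
  note turn = cut_quarter_turn[OF cut(1) Q]
  obtain k where k: "p - q = 2 * k" using even_quarter_turn_sym[OF Q] by blast
  have per: "\<alpha> (i + 2 * l) = \<alpha> i" for i l
    using cut_translation_preserving(1)[OF cut(1) Q translation_sym_multiple[OF T, of l]]
    by (simp add: mult.commute)
  have flip: "\<alpha> (2 * k - i - 1) = \<alpha> i" for i using turn(2)[of i] k by simp
  have "\<alpha> (i + 1) = \<alpha> i" for i
    using per[of "2 * k - i - 1" "i + 1 - k"] flip[of i] by (simp add: algebra_simps)
  then have "\<alpha> i = \<alpha> 0" for i by (rule constant_of_period_1)
  then show False using turn(3) cut(2,3) by metis
qed

text \<open>The translation vector and its image under the turn are perpendicular.\<close>

lemma periodic_translation_quarter_turn: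
  assumes Q: "quarter_turn_sym F p q \<delta>" and T: "translation_sym F 2 y False"
  shows "periodic F"
proof -
  let ?u = "Complex (of_int 2) (of_int y)" and ?v = "Complex (of_int (- y)) (of_int 2)"
  have "?u \<notin> span {?v}"
  proof
    assume "?u \<in> span {?v}"
    then obtain k where k: "?u = k *\<^sub>R ?v" unfolding span_singleton by blast
    have re: "2 = - (k * of_int y)" using arg_cong[OF k, of Re] by simp
    have im: "of_int y = k * 2" using arg_cong[OF k, of Im] by simp
    have "2 = - 2 * (k * k)" using re unfolding im by simp
    then show False using zero_le_square[of k] by linarith
  qed
  moreover have "?u \<noteq> ?v"
    using calculation span_base by fastforce
  moreover have "?v \<noteq> 0" by (simp add: complex_eq_iff)
  ultimately have "?u \<noteq> ?v \<and> independent {?u, ?v}"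
    by (intro conjI independent_insertI) (simp_all add: independent_empty)
  moreover have "\<forall>i j. F (i + 2, j + y) = F (i, j)" "\<forall>i j. F (i + - y, j + 2) = F (i, j)"
    using T translation_sym_rotate[OF Q T] unfolding translation_sym_def by simp_all
  ultimately show ?thesis unfolding periodic_def by blast
qed

section \<open>The group generated by side-preserving symmetries\<close>

lemma bij_plane_isometry: "plane_isometry g \<Longrightarrow> bij g"
  unfolding plane_isometry_def bij_def inj_def by (metis dist_eq_0_iff)

lemma plane_isometry_inv:
  assumes "plane_isometry g"
  shows "plane_isometry (inv_into UNIV g)"
proof -
  have "bij g" by (rule bij_plane_isometry[OF assms])
  then have "surj (inv_into UNIV g)" "g (inv_into UNIV g z) = z" for z
    by (auto simp: bij_imp_bij_inv bij_is_surj surj_f_inv_f)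
  then show ?thesis using assms unfolding plane_isometry_def by metis
qed

lemma group_motion_group: "group motion_group"
proof (rule groupI)
  fix x assume "x \<in> carrier motion_group"
  then obtain g \<epsilon> where x: "x = (g, \<epsilon>)" and g: "plane_isometry g" by (auto simp: motion_group_def)
  have "inv_into UNIV g \<circ> g = id" using bij_plane_isometry[OF g] by (simp add: bij_def)
  then show "\<exists>y\<in>carrier motion_group. y \<otimes>\<^bsub>motion_group\<^esub> x = \<one>\<^bsub>motion_group\<^esub>"
    using plane_isometry_inv[OF g] by (intro bexI[of _ "(inv_into UNIV g, \<epsilon>)"]) (auto simp: motion_group_def x)
next
  show "\<one>\<^bsub>motion_group\<^esub> \<in> carrier motion_group" by (simp add: motion_group_def plane_isometry_def)
qed (auto simp: motion_group_def comp_assoc intro: plane_isometry_comp)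

lemma motion_group_inv:
  assumes "plane_isometry g"
  shows "inv\<^bsub>motion_group\<^esub> (g, False) = (inv_into UNIV g, False)"
proof (rule group.inv_equality[OF group_motion_group])
  have "inv_into UNIV g \<circ> g = id" using bij_plane_isometry[OF assms] by (simp add: bij_def)
  then show "(inv_into UNIV g, False) \<otimes>\<^bsub>motion_group\<^esub> (g, False) = \<one>\<^bsub>motion_group\<^esub>"
    by (simp add: motion_group_def)
qed (use assms plane_isometry_inv in \<open>auto simp: motion_group_def\<close>)

text \<open>Surjectivity of the index maps is included so that closure under inverses can be read
  off from them.\<close>

definition proper_symmetries :: "prefabric \<Rightarrow> ((complex \<Rightarrow> complex) \<times> bool) set" where
  "proper_symmetries F = {(g, False) | g. \<exists>\<phi> \<sigma>. carries g \<phi> \<sigma> \<and> surj \<phi> \<and> surj \<sigma> \<and>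
     (\<forall>c. \<sigma> (top_strand F c) = top_strand F (\<phi> c))}"

lemma carries_inv:
  assumes c: "carries g \<phi> \<sigma>" and s: "surj \<phi>" "surj \<sigma>"
  shows "carries (inv_into UNIV g) (inv_into UNIV \<phi>) (inv_into UNIV \<sigma>)" "bij \<phi>" "bij \<sigma>"
proof -
  have g: "plane_isometry g" "bij g" using c bij_plane_isometry by (auto simp: carries_def)
  have cell: "g ` cell x = cell (\<phi> x)" and reg: "g ` region t = region (\<sigma> t)" for x t
    using c unfolding carries_def by blast+
  have inv: "inv_into UNIV g ` g ` A = A" for A using g(2) by (simp add: bij_is_inj image_inv_f_f)
  have "inv_into UNIV g ` cell x = cell (inv_into UNIV \<phi> x)" for x
    using inv[of "cell (inv_into UNIV \<phi> x)"] s(1) by (simp add: cell surj_f_inv_f)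
  moreover have "inv_into UNIV g ` region t = region (inv_into UNIV \<sigma> t)" for t
    using inv[of "region (inv_into UNIV \<sigma> t)"] s(2) by (simp add: reg surj_f_inv_f)
  ultimately show "carries (inv_into UNIV g) (inv_into UNIV \<phi>) (inv_into UNIV \<sigma>)"
    using plane_isometry_inv[OF g(1)] by (simp add: carries_def)
  have "inj \<phi>" using inv cell cell_eq_iff by (metis injI)
  then show "bij \<phi>" using s(1) by (simp add: bij_def)
  have "inj \<sigma>" using inv reg region_eq_iff by (metis injI)
  then show "bij \<sigma>" using s(2) by (simp add: bij_def)
qed

lemma subgroup_proper_symmetries: "subgroup (proper_symmetries F) motion_group"
proof (rule group.subgroupI[OF group_motion_group])
  show "proper_symmetries F \<subseteq> carrier motion_group"
    by (auto simp: proper_symmetries_def motion_group_def carries_def)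
  have "(id, False) \<in> proper_symmetries F"
    unfolding proper_symmetries_def
    by (auto intro!: exI[of _ id] simp: carries_def plane_isometry_def)
  then show "proper_symmetries F \<noteq> {}" by blast
  fix x assume "x \<in> proper_symmetries F"
  then obtain g \<phi> \<sigma> where x: "x = (g, False)" and c: "carries g \<phi> \<sigma>" and s: "surj \<phi>" "surj \<sigma>"
    and top: "\<And>c. \<sigma> (top_strand F c) = top_strand F (\<phi> c)"
    unfolding proper_symmetries_def by blast
  note inv = carries_inv[OF c s]
  have "inv_into UNIV \<sigma> (top_strand F c) = top_strand F (inv_into UNIV \<phi> c)" for c
    using top[of "inv_into UNIV \<phi> c"] inv(3) s(1) by (metis bij_inv_eq_iff surj_f_inv_f)
  moreover have "surj (inv_into UNIV \<phi>)" "surj (inv_into UNIV \<sigma>)"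
    using inv(2,3) bij_imp_bij_inv bij_is_surj by blast+
  ultimately have "(inv_into UNIV g, False) \<in> proper_symmetries F"
    using inv(1) unfolding proper_symmetries_def by blast
  then show "inv\<^bsub>motion_group\<^esub> x \<in> proper_symmetries F"
    using c motion_group_inv by (simp add: x carries_def)
  fix x' assume "x' \<in> proper_symmetries F"
  then obtain g' \<phi>' \<sigma>' where x': "x' = (g', False)" and c': "carries g' \<phi>' \<sigma>'"
    and s': "surj \<phi>'" "surj \<sigma>'" and top': "\<And>c. \<sigma>' (top_strand F c) = top_strand F (\<phi>' c)"
    unfolding proper_symmetries_def by blast
  have "surj (\<phi> \<circ> \<phi>')" "surj (\<sigma> \<circ> \<sigma>')" by (intro comp_surj s s')+
  moreover have "(\<sigma> \<circ> \<sigma>') (top_strand F c) = top_strand F ((\<phi> \<circ> \<phi>') c)" for c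
    by (simp add: top top')
  ultimately have "(g \<circ> g', False) \<in> proper_symmetries F"
    using carries_comp[OF c c'] unfolding proper_symmetries_def by blast
  then show "x \<otimes>\<^bsub>motion_group\<^esub> x' \<in> proper_symmetries F" by (simp add: x x' motion_group_def)
qed

lemma proper_symmetries_subset: "proper_symmetries F \<subseteq> symmetries F"
  unfolding proper_symmetries_def using symmetries_iff by auto

text \<open>A quarter-turn about \<open>c\<close> is
  \<open>z \<mapsto> \<i> z + (1 - \<i>) c\<close>, whence the parameters \<open>k + l\<close> and
  \<open>l - k\<close>.\<close>

lemma quarter_turn_proper_symmetry:
  assumes "quarter_turn_sym F (k + l) (l - k) False"
  shows "(rotation (Complex (of_int k) (of_int l)) \<i>, False) \<in> proper_symmetries F"
proof -
  let ?p = "k + l" and ?q = "l - k"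
  let ?\<phi> = "\<lambda>(i, j). (?p - j - 1, ?q + i)"
  let ?\<sigma> = "case_strand (\<lambda>i. Weft (?q + i)) (\<lambda>j. Warp (?p - j - 1))"
  have rot: "rotation (Complex (of_int k) (of_int l)) \<i> =
      (\<lambda>z. \<i> * z + Complex (of_int ?p) (of_int ?q))"
    by (auto simp: rotation_def complex_eq_iff)
  have "surj ?\<phi>"
    by (rule surjI[where f = "\<lambda>(i, j). (j - ?q, ?p - i - 1)"]) auto
  moreover have "surj ?\<sigma>"
    by (rule surjI[where f = "case_strand (\<lambda>i. Weft (?p - i - 1)) (\<lambda>j. Warp (j - ?q))"])
      (auto split: strand.split)
  moreover have "?\<sigma> (top_strand F c) = top_strand F (?\<phi> c)" for c
    using assms by (cases c) (auto simp: quarter_turn_sym_def top_strand_def)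
  ultimately show ?thesis
    using carries_quarter_turn[of ?p ?q] unfolding proper_symmetries_def rot by blast
qed

text \<open>Inverses in the structure with carrier \<open>K\<close> are a definite description over
  \<open>K\<close>; uniqueness of inverses in \<open>G\<close> identifies them with those of
  \<open>G\<close>.\<close>

lemma (in group) subgroup_of_carrier_update:
  assumes H: "subgroup H G" "H \<subseteq> K" and K: "K \<subseteq> carrier G"
  shows "subgroup H (G\<lparr>carrier := K\<rparr>)"
proof
  fix x assume x: "x \<in> H"
  then have xG: "x \<in> carrier G" and inv: "inv x \<in> H"
    using H by (auto simp: subgroup.mem_carrier subgroup.m_inv_closed)
  have "inv\<^bsub>G\<lparr>carrier := K\<rparr>\<^esub> x = inv x"
    unfolding m_inv_def[of "G\<lparr>carrier := K\<rparr>"]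
  proof (rule the_equality)
    show "inv x \<in> carrier (G\<lparr>carrier := K\<rparr>) \<and>
        x \<otimes>\<^bsub>G\<lparr>carrier := K\<rparr>\<^esub> inv x = \<one>\<^bsub>G\<lparr>carrier := K\<rparr>\<^esub> \<and>
        inv x \<otimes>\<^bsub>G\<lparr>carrier := K\<rparr>\<^esub> x = \<one>\<^bsub>G\<lparr>carrier := K\<rparr>\<^esub>"
      using inv xG H(2) by auto
  next
    fix y assume "y \<in> carrier (G\<lparr>carrier := K\<rparr>) \<and>
        x \<otimes>\<^bsub>G\<lparr>carrier := K\<rparr>\<^esub> y = \<one>\<^bsub>G\<lparr>carrier := K\<rparr>\<^esub> \<and>
        y \<otimes>\<^bsub>G\<lparr>carrier := K\<rparr>\<^esub> x = \<one>\<^bsub>G\<lparr>carrier := K\<rparr>\<^esub>"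
    then show "y = inv x" using K inv_equality[of y x] xG by auto
  qed
  then show "inv\<^bsub>G\<lparr>carrier := K\<rparr>\<^esub> x \<in> H" using inv by simp
qed (use H in \<open>auto simp: subgroup.m_closed subgroup.one_closed\<close>)

text \<open>The second generator is the first followed by the translation. For
  \<open>n = 2 m + 1\<close> the centres differ by \<open>(- 2 m, 2 (m + 1))\<close>, and
  \<open>m\<close>, \<open>m + 1\<close> are coprime of opposite parity.\<close>

lemma ex_subgroup_type_33_4:
  assumes Q: "quarter_turn_sym F p q False" and T: "translation_sym F 2 (2 * n) False" and n: "odd n"
  shows "\<exists>H. subgroup H (symmetry_group F) \<and> type_33_4 H"
proof -
  obtain k where k: "p - q = 2 * k" using even_quarter_turn_sym[OF Q] by blast
  obtain m where m: "n = 2 * m + 1" using n by (rule oddE)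
  \<comment> \<open>This makes \<open>(k, l)\<close> the centre of the given quarter-turn, a corner
    of cells because \<open>p - q\<close> is even.\<close>
  define l where "l = q + k"
  have pq: "p = k + l" "q = l - k" using k by (auto simp: l_def)
  \<comment> \<open>The second centre is \<open>c + (2 + 2 n \<i>) / (1 - \<i>)\<close>.\<close>
  let ?c = "Complex (of_int k) (of_int l)"
  let ?d = "Complex (of_int (k - 2 * m)) (of_int (l + 2 * (m + 1)))"
  let ?S = "{(rotation ?c \<i>, False), (rotation ?d \<i>, False)}"
  have "quarter_turn_sym F (p + 2) (q + 2 * n) False"
    using quarter_turn_sym_translate[OF Q T] by simp
  then have "quarter_turn_sym F (k - 2 * m + (l + 2 * (m + 1))) (l + 2 * (m + 1) - (k - 2 * m)) False"
    by (simp add: pq m algebra_simps)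
  from quarter_turn_proper_symmetry[OF this] quarter_turn_proper_symmetry[OF Q[unfolded pq]]
  have S: "?S \<subseteq> proper_symmetries F" by blast
  let ?H = "generate motion_group ?S"
  interpret group motion_group by (rule group_motion_group)
  have "?S \<subseteq> carrier motion_group"
    using S subgroup.subset[OF subgroup_proper_symmetries] by blast
  then have "subgroup ?H motion_group" by (rule generate_is_subgroup)
  moreover have "?H \<subseteq> symmetries F"
    using generate_subgroup_incl[OF S subgroup_proper_symmetries] proper_symmetries_subset by blast
  moreover have "symmetries F \<subseteq> carrier motion_group"
    by (auto simp: symmetries_def motion_group_def)
  ultimately have "subgroup ?H (symmetry_group F)"
    unfolding symmetry_group_def by (rule subgroup_of_carrier_update)
  moreover have "type_33_4 ?H"
    unfolding type_33_4_def
  proof (rule exI[of _ ?c], rule exI[of _ ?d], rule exI[of _ "- m"], rule exI[of _ "m + 1"],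
      rule exI[of _ k], rule exI[of _ l], intro conjI)
    show "?d - ?c = Complex (of_int (2 * (- m))) (of_int (2 * (m + 1)))"
      by (simp add: complex_eq_iff)
    show "coprime (- m) (m + 1)" by simp
    show "even (- m) \<longleftrightarrow> odd (m + 1)" by simp
  qed (rule refl)+
  ultimately show ?thesis by blast
qed

theorem theorem5p1:
  fixes P :: prefabric
  assumes "periodic P"
    and "isonemal P"
    and "quarter_turn_symmetry P"
    and "non_exceptional P"
    and "falls_apart P"
  shows "\<exists>(F :: prefabric) col.
           fabric F \<and> thick_striping col \<and> pattern F col = P \<and>
           (species_33_4 F \<or> (\<exists>H. subgroup H (symmetry_group F) \<and> type_33_4 H))"
proof -
  obtain p q where Q: "quarter_turn_sym P p q False"
    using ex_quarter_turn_sym[OF assms(3,4)] ex_side_preserving_quarter_turn[OF assms(1,2,4,5)] by blast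
  obtain \<alpha> \<beta> where cut: "cut P \<alpha> \<beta>"
    "(\<exists>i. \<alpha> i) \<or> (\<exists>j. \<beta> j)" "(\<exists>i. \<not> \<alpha> i) \<or> (\<exists>j. \<not> \<beta> j)"
    using falls_apart_cut[OF assms(5)] by blast
  obtain n where T: "translation_sym P 2 (2 * n) True" and n: "odd n"
    and \<alpha>: "\<And>i. \<alpha> (i + 2) = (\<not> \<alpha> i)"
    using thick_cut[OF assms(2,4) cut Q] by blast
  \<comment> \<open>The wefts inherit antiperiod 2 from the warps through
    \<open>\<beta> j = \<alpha> (p - j - 1)\<close>.\<close>
  have \<beta>: "\<beta> (j + 2 * k) = (\<beta> j \<noteq> odd k)" for j k
    using antiperiodic_shift[of \<alpha>, OF \<alpha>, of "p - j - 1" "- k"] cut_quarter_turn(3)[OF cut(1) Q]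
    by (simp add: algebra_simps)
  define F where "F = weave P \<alpha> \<beta>"
  define col where "col = case_strand \<alpha> (\<lambda>j. \<not> \<beta> j)"
  have QF: "quarter_turn_sym F p q False"
    unfolding F_def by (rule weave_quarter_turn_sym[OF cut(1) Q])
  have TF: "translation_sym F 2 (2 * n) False"
    unfolding F_def by (rule weave_translation_sym[OF T]) (simp_all add: \<alpha> \<beta> n)
  have "fabric F"
    using periodic_translation_quarter_turn[OF QF TF] not_falls_apart[OF QF TF] by (simp add: fabric_def)
  moreover obtain m where "\<And>i. \<alpha> i \<longleftrightarrow> (i - m) mod 4 < 2"
    using antiperiodic_thick[of \<alpha>, OF \<alpha>] by blast
  moreover obtain m' where "\<And>j. (\<not> \<beta> j) \<longleftrightarrow> (j - m') mod 4 < 2"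
    using antiperiodic_thick[of "\<lambda>j. \<not> \<beta> j"] \<beta>[of _ 1] by auto
  ultimately have "fabric F" "thick_striping col"
    by (auto simp: thick_striping_def col_def)
  moreover have "pattern F col = P" unfolding F_def col_def by (rule pattern_weave[OF cut(1)])
  ultimately show ?thesis using ex_subgroup_type_33_4[OF QF TF n] by blast
qed

end
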